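(* Let $d\ge 2$ and $m\ge 2$, let $\mathcal X=\{X_1,\dots,X_m\}$ be a set of pairwise distinct points in $\mathbb R^d$ and $\mathbf p=\{p_1,\dots,p_m\}$ a set of $m$ nonnegative integers. Let $$I=I(\mathcal X,\mathbf p)=\Big\{f\in\Pi^d:\ \frac{\partial^{\alpha_1+\dots+\alpha_d}}{\partial x_1^{\alpha_1}\cdots\partial x_d^{\alpha_d}}f(X_q)=0,\ 1\le q\le m,\ 0\le|\alpha|\le p_q\Big\}.$$ Then for any given real numbers $c_{q,\alpha}$ ($1\le q\le m$, $\alpha\in\mathbb N_0^d$, $0\le|\alpha|\le p_q$), there is a unique polynomial $f\in\mathcal S_I$ such that $$\frac{\partial^{\alpha_1+\dots+\alpha_d}}{\partial x_1^{\alpha_1}\cdots\partial x_d^{\alpha_d}}f(X_q)=c_{q,\alpha},\qquad 1\le q\le m,\quad 0\le|\alpha|\le p_q.$$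
   Context: $\Pi^d=\mathbb R[x_1,\dots,x_d]$, and $|\alpha|=\alpha_1+\dots+\alpha_d$ for $\alpha\in\mathbb N_0^d$. Monomials are ordered by the graded lexicographic order. For a nonzero polynomial $f$, $LT(f)$ denotes its leading term; for an ideal $I\subset\Pi^d$, $\langle LT(I)\rangle$ denotes the ideal generated by the leading terms $LT(f)$, $f\in I\setminus\{0\}$. The space $\mathcal S_I$ is the real linear span $\mathcal S_I=\mathrm{Span}\{X^\alpha : X^\alpha\notin\langle LT(I)\rangle\}$ of the monomials $X^\alpha=x_1^{\alpha_1}\cdots x_d^{\alpha_d}$ not lying in $\langle LT(I)\rangle$. *)

theory Defs
  imports "HOL-Analysis.Analysis" "HOL-Library.Poly_Mapping"
begin

text \<open>
  The variables \<open>x\<^sub>1, \<dots>, x\<^sub>d\<close> are indexed by a finite linearly ordered type \<open>'d\<close> with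
  \<open>d = CARD('d)\<close> elements; \<open>x\<^sub>1\<close> belongs to its least element. Multi-indices are
  \<open>'d \<Rightarrow>\<^sub>0 nat\<close>, and polynomials are finitely supported families of coefficients, with
  the ring structure (convolution product) of \<^theory>\<open>HOL-Library.Poly_Mapping\<close>.
\<close>

type_synonym 'd multi_index = "'d \<Rightarrow>\<^sub>0 nat"
type_synonym 'd mpoly = "('d \<Rightarrow>\<^sub>0 nat) \<Rightarrow>\<^sub>0 real"

definition total_deg :: "'d::finite multi_index \<Rightarrow> nat" where
  "total_deg \<alpha> = (\<Sum>i\<in>UNIV. Poly_Mapping.lookup \<alpha> i)"

definition monomial :: "'d multi_index \<Rightarrow> 'd mpoly" where
  "monomial \<alpha> = Poly_Mapping.single \<alpha> 1"

definition eval_mpoly :: "'d::finite mpoly \<Rightarrow> real ^ 'd \<Rightarrow> real" where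
  "eval_mpoly f x =
    (\<Sum>\<alpha>\<in>Poly_Mapping.keys f.
       Poly_Mapping.lookup f \<alpha> * (\<Prod>i\<in>UNIV. (x $ i) ^ Poly_Mapping.lookup \<alpha> i))"


subsection \<open>Partial derivatives\<close>

text \<open>
  If the exponent of \<open>x\<^sub>i\<close> in \<open>\<alpha>\<close> is \<open>0\<close>, the truncated subtraction is harmless, since the
  coefficient vanishes. That this is the analytic partial derivative is lemma
  \<open>has_real_derivative_eval_mpoly\<close>.
\<close>

definition partial_deriv :: "'d \<Rightarrow> 'd mpoly \<Rightarrow> 'd mpoly" where
  "partial_deriv i f =
    (\<Sum>\<alpha>\<in>Poly_Mapping.keys f.
       Poly_Mapping.single (\<alpha> - Poly_Mapping.single i 1)
         (Poly_Mapping.lookup f \<alpha> * real (Poly_Mapping.lookup \<alpha> i)))"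

definition partial_derivs :: "'d::{finite,linorder} multi_index \<Rightarrow> 'd mpoly \<Rightarrow> 'd mpoly" where
  "partial_derivs \<alpha> =
    foldr (\<lambda>i. partial_deriv i ^^ Poly_Mapping.lookup \<alpha> i) (sorted_list_of_set UNIV)"


subsection \<open>Leading terms for the graded lexicographic order\<close>

text \<open>
  The order \<open><\<close> on \<open>'d \<Rightarrow>\<^sub>0 nat\<close> is the lexicographic one: the smallest index where two
  multi-indices differ decides (lemma \<open>grlex_less_iff\<close>). Hence the variables satisfy
  \<open>x\<^sub>1 > \<dots> > x\<^sub>d\<close>.
\<close>

definition grlex_less :: "'d::{finite,linorder} multi_index \<Rightarrow> 'd multi_index \<Rightarrow> bool" where
  "grlex_less \<alpha> \<beta> \<longleftrightarrow>
     total_deg \<alpha> < total_deg \<beta> \<or> total_deg \<alpha> = total_deg \<beta> \<and> \<alpha> < \<beta>"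

text \<open>The leading exponent and the leading term are meaningful for nonzero polynomials only.\<close>

definition lead_exp :: "'d::{finite,linorder} mpoly \<Rightarrow> 'd multi_index" where
  "lead_exp f = (THE \<alpha>. \<alpha> \<in> Poly_Mapping.keys f \<and>
     (\<forall>\<beta>\<in>Poly_Mapping.keys f. \<beta> \<noteq> \<alpha> \<longrightarrow> grlex_less \<beta> \<alpha>))"

definition lead_term :: "'d::{finite,linorder} mpoly \<Rightarrow> 'd mpoly" where
  "lead_term f = Poly_Mapping.single (lead_exp f) (Poly_Mapping.lookup f (lead_exp f))"

text \<open>The ideal generated by a set is its span in the ring viewed as a module over itself.\<close>

definition ideal_generated :: "'d mpoly set \<Rightarrow> 'd mpoly set" where
  "ideal_generated = module.span (*)"

definition lead_ideal :: "'d::{finite,linorder} mpoly set \<Rightarrow> 'd mpoly set" where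
  "lead_ideal I = ideal_generated (lead_term ` (I - {0}))"

definition scale_mpoly :: "real \<Rightarrow> 'd mpoly \<Rightarrow> 'd mpoly" where
  "scale_mpoly c f = Poly_Mapping.map ((*) c) f"

definition S_space :: "'d::{finite,linorder} mpoly set \<Rightarrow> 'd mpoly set" where
  "S_space I = module.span scale_mpoly {monomial \<alpha> |\<alpha>. monomial \<alpha> \<notin> lead_ideal I}"


subsection \<open>The ideal of Hermite interpolation\<close>

definition hermite_ideal ::
    "nat \<Rightarrow> (nat \<Rightarrow> real ^ 'd::{finite,linorder}) \<Rightarrow> (nat \<Rightarrow> nat) \<Rightarrow> 'd mpoly set" where
  "hermite_ideal m X p =
    {f. \<forall>q\<in>{1..m}. \<forall>\<alpha>. total_deg \<alpha> \<le> p q \<longrightarrow> eval_mpoly (partial_derivs \<alpha> f) (X q) = 0}"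


subsection \<open>Basic facts\<close>

lemma module_mpoly_times: "module ((*) :: 'd mpoly \<Rightarrow> 'd mpoly \<Rightarrow> 'd mpoly)"
  by unfold_locales (simp_all add: algebra_simps)

lemma vector_space_scale_mpoly: "vector_space (scale_mpoly :: real \<Rightarrow> 'd mpoly \<Rightarrow> 'd mpoly)"
  by unfold_locales
    (simp_all add: scale_mpoly_def mult_map_scale_conv_mult single_add mult_single
      ring_distribs flip: mult.assoc)

lemma module_scale_mpoly: "module (scale_mpoly :: real \<Rightarrow> 'd mpoly \<Rightarrow> 'd mpoly)"
  using vector_space_scale_mpoly by (simp add: module_iff_vector_space)

lemma grlex_less_iff:
  "grlex_less \<alpha> \<beta> \<longleftrightarrow> total_deg \<alpha> < total_deg \<beta> \<or> total_deg \<alpha> = total_deg \<beta> \<and>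
     (\<exists>i. Poly_Mapping.lookup \<alpha> i < Poly_Mapping.lookup \<beta> i \<and>
       (\<forall>j<i. Poly_Mapping.lookup \<alpha> j = Poly_Mapping.lookup \<beta> j))"
  by (simp add: grlex_less_def less_poly_mapping.rep_eq less_fun_def)

lemma lead_exp:
  assumes "f \<noteq> 0"
  shows "lead_exp f \<in> Poly_Mapping.keys f"
    and "\<And>\<beta>. \<beta> \<in> Poly_Mapping.keys f \<Longrightarrow> \<beta> \<noteq> lead_exp f \<Longrightarrow> grlex_less \<beta> (lead_exp f)"
proof -
  let ?K = "Poly_Mapping.keys f"
  define D where "D = Max (total_deg ` ?K)"
  define L where "L = {\<alpha>\<in>?K. total_deg \<alpha> = D}"
  have K: "finite ?K" "?K \<noteq> {}" using assms by auto
  then have "D \<in> total_deg ` ?K" unfolding D_def by simp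
  then have L: "finite L" "L \<noteq> {}" using K by (auto simp: L_def)
  have top: "Max L \<in> ?K \<and> (\<forall>\<beta>\<in>?K. \<beta> \<noteq> Max L \<longrightarrow> grlex_less \<beta> (Max L))"
  proof (intro conjI ballI impI)
    have top_in: "Max L \<in> L" using L by (rule Max_in)
    then show "Max L \<in> ?K" by (simp add: L_def)
    fix \<beta> assume b: "\<beta> \<in> ?K" "\<beta> \<noteq> Max L"
    have le: "total_deg \<beta> \<le> D" using b K by (simp add: D_def)
    have DM: "total_deg (Max L) = D" using top_in by (simp add: L_def)
    show "grlex_less \<beta> (Max L)"
    proof (cases "total_deg \<beta> = D")
      case True
      then have "\<beta> \<in> L" using b by (simp add: L_def)
      then have "\<beta> \<le> Max L" using L by simp
      with b DM True show ?thesis by (simp add: grlex_less_def)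
    next
      case False
      with le DM show ?thesis by (simp add: grlex_less_def)
    qed
  qed
  have "lead_exp f = Max L"
    unfolding lead_exp_def
  proof (rule the_equality)
    show "Max L \<in> ?K \<and> (\<forall>\<beta>\<in>?K. \<beta> \<noteq> Max L \<longrightarrow> grlex_less \<beta> (Max L))" by (rule top)
    fix \<alpha> assume a: "\<alpha> \<in> ?K \<and> (\<forall>\<beta>\<in>?K. \<beta> \<noteq> \<alpha> \<longrightarrow> grlex_less \<beta> \<alpha>)"
    show "\<alpha> = Max L"
    proof (rule ccontr)
      assume "\<alpha> \<noteq> Max L"
      then have "grlex_less \<alpha> (Max L)" "grlex_less (Max L) \<alpha>" using a top by auto
      then show False by (auto simp: grlex_less_def)
    qed
  qed
  with top show "lead_exp f \<in> ?K"
    and "\<And>\<beta>. \<beta> \<in> ?K \<Longrightarrow> \<beta> \<noteq> lead_exp f \<Longrightarrow> grlex_less \<beta> (lead_exp f)"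
    by simp_all
qed

lemma eval_mpoly_superset:
  assumes "finite A" "Poly_Mapping.keys f \<subseteq> A"
  shows "eval_mpoly f x =
    (\<Sum>\<alpha>\<in>A. Poly_Mapping.lookup f \<alpha> * (\<Prod>i\<in>UNIV. (x $ i) ^ Poly_Mapping.lookup \<alpha> i))"
  unfolding eval_mpoly_def using assms
  by (intro sum.mono_neutral_left) (auto simp: in_keys_iff)

lemma eval_mpoly_zero [simp]: "eval_mpoly 0 x = 0"
  by (simp add: eval_mpoly_def)

lemma eval_mpoly_single:
  "eval_mpoly (Poly_Mapping.single \<alpha> c) x = c * (\<Prod>i\<in>UNIV. (x $ i) ^ Poly_Mapping.lookup \<alpha> i)"
  by (simp add: eval_mpoly_superset[of "{\<alpha>}"])

lemma eval_mpoly_add: "eval_mpoly (f + g) x = eval_mpoly f x + eval_mpoly g x"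
proof -
  let ?A = "Poly_Mapping.keys f \<union> Poly_Mapping.keys g"
  have "Poly_Mapping.keys (f + g) \<subseteq> ?A" by (rule keys_add)
  then show ?thesis
    by (simp add: eval_mpoly_superset[of ?A] lookup_add sum.distrib distrib_right)
qed

lemma eval_mpoly_sum: "eval_mpoly (sum F A) x = (\<Sum>a\<in>A. eval_mpoly (F a) x)"
  by (induction A rule: infinite_finite_induct) (simp_all add: eval_mpoly_add)

lemma has_real_derivative_eval_mpoly:
  "((\<lambda>t. eval_mpoly f (x + t *\<^sub>R axis i 1)) has_real_derivative
     eval_mpoly (partial_deriv i f) (x + t *\<^sub>R axis i 1)) (at t)"
proof -
  let ?l = "Poly_Mapping.lookup"
  define y where "y = x + t *\<^sub>R axis i 1"
  define P where "P \<alpha> = (\<Prod>j\<in>UNIV - {i}. (x $ j) ^ ?l \<alpha> j)" for \<alpha>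
  have split: "(\<Prod>j\<in>UNIV. ((x + s *\<^sub>R axis i 1) $ j) ^ ?l \<alpha> j) = (x $ i + s) ^ ?l \<alpha> i * P \<alpha>"
    for s :: real and \<alpha>
    unfolding P_def by (subst prod.remove[of UNIV i]) (auto simp: axis_def intro!: prod.cong)
  have P: "P (\<alpha> - Poly_Mapping.single i 1) = P \<alpha>" for \<alpha>
    unfolding P_def by (intro prod.cong) (auto simp: lookup_minus lookup_single when_def)
  have "eval_mpoly (partial_deriv i f) y =
      (\<Sum>\<alpha>\<in>Poly_Mapping.keys f. ?l f \<alpha> * (real (?l \<alpha> i) * (x $ i + t) ^ (?l \<alpha> i - 1) * P \<alpha>))"
    unfolding partial_deriv_def y_def eval_mpoly_sum eval_mpoly_single split P
    by (simp add: lookup_minus mult.assoc)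
  then show ?thesis
    unfolding y_def eval_mpoly_def[of f] split
    by (auto intro!: derivative_eq_intros sum.cong)
qed

end

theory Submission
  imports Defs
begin

text \<open>
  Write \<open>D\<^sub>\<beta>\<^sub>,\<^sub>a f\<close> for the derivative of \<open>f\<close> of multi-index \<open>\<beta>\<close> at the point \<open>a\<close>, and \<open>e\<^sub>i\<close> for the
  \<open>i\<close>-th unit multi-index. All analytic input is one identity (\<open>deriv_at_mult_linear\<close>), which
  comes from the commutation of differentiation with multiplication by a variable:

  \<open>D\<^sub>\<beta>\<^sub>,\<^sub>a ((x\<^sub>i - b) f) = (a\<^sub>i - b) D\<^sub>\<beta>\<^sub>,\<^sub>a f + \<beta>\<^sub>i D\<^bsub>\<beta> - e\<^sub>i, a\<^esub> f\<close>.

  It shows that vanishing at \<open>a\<close> to a given order survives multiplication by any polynomial, so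
  that \<open>I\<close> is an ideal, and that a factor \<open>x\<^sub>i - a\<^sub>i\<close> raises the order by one.

  Existence has two halves. Some polynomial \<open>F\<close>, without any restriction on its
  monomials, has the prescribed derivatives (\<open>exists_hermite_interpolant\<close>): products of linear
  factors separate a node from the others, further factors \<open>x\<^sub>i - a\<^sub>i\<close> at the node \<open>a\<close> make all
  derivatives of order at most \<open>|\<alpha>|\<close> vanish except the one of index \<open>\<alpha>\<close>, and the prescribed
  values are then met order by order. Dividing \<open>F\<close> by the ideal \<open>I\<close> leaves a remainder in \<open>\<S>\<^sub>I\<close>
  (\<open>exists_remainder\<close>): as long as the leading monomial lies in the leading ideal, it is the
  leading monomial of an element of \<open>I\<close> and can be cancelled; otherwise it is moved into the
  remainder. Subtracting an element of \<open>I\<close> does not change the prescribed derivatives.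

  Uniqueness holds since two solutions differ by an element of \<open>\<S>\<^sub>I \<inter> I\<close>. If that element were
  nonzero, its leading monomial would lie outside the leading ideal, as do all monomials of
  elements of \<open>\<S>\<^sub>I\<close>, and inside it, as do all leading monomials of elements of \<open>I\<close>
  (\<open>S_space_Int_ideal\<close>).
\<close>

section \<open>Multi-indices\<close>

lemma total_deg_zero [simp]: "total_deg 0 = 0"
  by (simp add: total_deg_def)

lemma total_deg_add: "total_deg (\<alpha> + \<beta>) = total_deg \<alpha> + total_deg \<beta>"
  by (simp add: total_deg_def lookup_add sum.distrib)

lemma total_deg_single [simp]: "total_deg (Poly_Mapping.single i k) = k"
  by (simp add: total_deg_def lookup_single when_def)

lemma multi_index_remove_unit:
  fixes \<beta> :: "'d multi_index"
  assumes "Poly_Mapping.lookup \<beta> i > 0"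
  shows "\<beta> - Poly_Mapping.single i 1 + Poly_Mapping.single i 1 = \<beta>"
  using assms by (intro poly_mapping_eqI) (auto simp: lookup_add lookup_minus lookup_single when_def)

lemma total_deg_remove_unit:
  fixes \<beta> :: "'d::finite multi_index"
  assumes "Poly_Mapping.lookup \<beta> i > 0"
  shows "total_deg \<beta> = Suc (total_deg (\<beta> - Poly_Mapping.single i 1))"
  using multi_index_remove_unit[OF assms] by (metis total_deg_add total_deg_single Suc_eq_plus1)

lemma multi_index_induct [case_names zero add_unit]:
  fixes \<alpha> :: "'d::finite multi_index"
  assumes zero: "P 0"
    and add_unit: "\<And>\<alpha> i. P \<alpha> \<Longrightarrow> P (\<alpha> + Poly_Mapping.single i 1)"
  shows "P \<alpha>"
proof (induction "total_deg \<alpha>" arbitrary: \<alpha>)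
  case 0
  then have "\<alpha> = 0" by (auto simp: total_deg_def intro!: poly_mapping_eqI)
  with zero show ?case by simp
next
  case (Suc n)
  then have "\<alpha> \<noteq> 0" by auto
  then obtain i where "Poly_Mapping.lookup \<alpha> i > 0"
    by (metis gr0I lookup_zero poly_mapping_eqI)
  then have \<alpha>: "\<alpha> - Poly_Mapping.single i 1 + Poly_Mapping.single i 1 = \<alpha>"
    and "total_deg \<alpha> = Suc (total_deg (\<alpha> - Poly_Mapping.single i 1))"
    by (rule multi_index_remove_unit, rule total_deg_remove_unit)
  with Suc have "P (\<alpha> - Poly_Mapping.single i 1)" by simp
  then show ?case using add_unit[of "\<alpha> - Poly_Mapping.single i 1" i] \<alpha> by simp
qed

lemma finite_total_deg_le: "finite {\<alpha> :: 'd::finite multi_index. total_deg \<alpha> \<le> n}"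
proof (rule finite_imageD)
  have "Poly_Mapping.lookup \<alpha> i \<le> n" if "total_deg \<alpha> \<le> n" for \<alpha> :: "'d multi_index" and i
    using that member_le_sum[of i UNIV "Poly_Mapping.lookup \<alpha>"] by (simp add: total_deg_def)
  then have "Poly_Mapping.lookup ` {\<alpha> :: 'd multi_index. total_deg \<alpha> \<le> n}
      \<subseteq> (\<Pi>\<^sub>E i\<in>UNIV. {..n})"
    by auto
  then show "finite (Poly_Mapping.lookup ` {\<alpha> :: 'd multi_index. total_deg \<alpha> \<le> n})"
    by (rule finite_subset) (simp add: finite_PiE)
  show "inj_on Poly_Mapping.lookup {\<alpha> :: 'd multi_index. total_deg \<alpha> \<le> n}"
    by (simp add: inj_on_def)
qed

lemma grlex_less_irrefl: "\<not> grlex_less \<alpha> \<alpha>"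
  by (simp add: grlex_less_def)

lemma grlex_less_trans: "grlex_less \<alpha> \<beta> \<Longrightarrow> grlex_less \<beta> \<gamma> \<Longrightarrow> grlex_less \<alpha> \<gamma>"
  by (auto simp: grlex_less_def)

lemma grlex_less_add_left: "grlex_less \<alpha> \<beta> \<Longrightarrow> grlex_less (\<gamma> + \<alpha>) (\<gamma> + \<beta>)"
  by (simp add: grlex_less_iff total_deg_add lookup_add)

text \<open>
  Comparing total degrees first leaves only finitely many multi-indices below a given one, so
  counting them is a termination measure.
\<close>

lemma wfp_grlex_less: "wfp (grlex_less :: 'd::{finite,linorder} multi_index \<Rightarrow> _)"
proof -
  have fin: "finite {\<gamma>. grlex_less \<gamma> \<alpha>}" for \<alpha> :: "'d multi_index"
    by (rule finite_subset[OF _ finite_total_deg_le[of "total_deg \<alpha>"]]) (auto simp: grlex_less_def)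
  have "card {\<gamma>. grlex_less \<gamma> \<alpha>} < card {\<gamma>. grlex_less \<gamma> \<beta>}"
    if "grlex_less \<alpha> \<beta>" for \<alpha> \<beta> :: "'d multi_index"
    using that grlex_less_trans grlex_less_irrefl by (intro psubset_card_mono fin) blast
  then show ?thesis
    by (intro wfp_if_convertible_to_nat[where f = "\<lambda>\<alpha>. card {\<gamma>. grlex_less \<gamma> \<alpha>}"])
qed


section \<open>Polynomials\<close>

lemma mpoly_induct [case_names zero add_term]:
  fixes f :: "'d mpoly"
  assumes zero: "P 0"
    and add_term: "\<And>f \<alpha> c. P f \<Longrightarrow> P (f + Poly_Mapping.single \<alpha> c)"
  shows "P f"
proof (induction f rule: update_induct)
  case const
  show ?case by (rule zero)
next
  case (update f \<alpha> c)
  have "Poly_Mapping.update \<alpha> c f = f + Poly_Mapping.single \<alpha> c"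
    using update(1)
    by (intro poly_mapping_eqI) (auto simp: lookup_update lookup_add lookup_single in_keys_iff)
  then show ?case using add_term[OF update(3)] by simp
qed

definition var :: "'d \<Rightarrow> 'd mpoly" where
  "var i = monomial (Poly_Mapping.single i 1)"

lemma scale_mpoly_eq_mult: "scale_mpoly c f = Poly_Mapping.single 0 c * f"
  by (simp add: scale_mpoly_def mult_map_scale_conv_mult)

lemma partial_deriv_superset:
  assumes "finite A" "Poly_Mapping.keys f \<subseteq> A"
  shows "partial_deriv i f = (\<Sum>\<alpha>\<in>A. Poly_Mapping.single (\<alpha> - Poly_Mapping.single i 1)
    (Poly_Mapping.lookup f \<alpha> * real (Poly_Mapping.lookup \<alpha> i)))"
  unfolding partial_deriv_def using assms
  by (intro sum.mono_neutral_left) (auto simp: in_keys_iff)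

lemma partial_deriv_zero [simp]: "partial_deriv i 0 = 0"
  by (simp add: partial_deriv_def)

lemma partial_deriv_single:
  "partial_deriv i (Poly_Mapping.single \<alpha> c) =
    Poly_Mapping.single (\<alpha> - Poly_Mapping.single i 1) (c * real (Poly_Mapping.lookup \<alpha> i))"
  by (simp add: partial_deriv_superset[of "{\<alpha>}"])

lemma partial_deriv_add: "partial_deriv i (f + g) = partial_deriv i f + partial_deriv i g"
proof -
  let ?A = "Poly_Mapping.keys f \<union> Poly_Mapping.keys g"
  have "Poly_Mapping.keys (f + g) \<subseteq> ?A" by (rule keys_add)
  then show ?thesis
    by (simp add: partial_deriv_superset[of ?A] lookup_add sum.distrib distrib_right single_add)
qed

lemma partial_deriv_mult_const:
  "partial_deriv i (Poly_Mapping.single 0 c * f) = Poly_Mapping.single 0 c * partial_deriv i f"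
proof (induction f rule: mpoly_induct)
  case zero
  show ?case by simp
next
  case (add_term f \<alpha> b)
  then show ?case
    by (simp add: partial_deriv_add partial_deriv_single distrib_left mult_single mult.assoc)
qed

lemma eval_mpoly_mult_const: "eval_mpoly (Poly_Mapping.single 0 c * f) a = c * eval_mpoly f a"
  by (induction f rule: mpoly_induct)
    (simp_all add: eval_mpoly_add eval_mpoly_single distrib_left mult_single mult.assoc)

lemma eval_mpoly_mult_var:
  "eval_mpoly (var i * f) a = a $ i * eval_mpoly f a"
proof (induction f rule: mpoly_induct)
  case zero
  show ?case by simp
next
  case (add_term f \<alpha> c)
  have "(\<Prod>j\<in>UNIV. (a $ j) ^ Poly_Mapping.lookup (Poly_Mapping.single i 1 :: 'a multi_index) j) = a $ i"
    by (subst prod.remove[of UNIV i]) (auto simp: lookup_single)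
  then have "(\<Prod>j\<in>UNIV. (a $ j) ^ Poly_Mapping.lookup (Poly_Mapping.single i 1 + \<alpha>) j) =
      a $ i * (\<Prod>j\<in>UNIV. (a $ j) ^ Poly_Mapping.lookup \<alpha> j)"
    by (simp add: lookup_add power_add prod.distrib)
  with add_term show ?case
    by (simp add: eval_mpoly_add eval_mpoly_single distrib_left mult_single var_def monomial_def)
qed

text \<open>
  This is the Weyl algebra relation \<open>\<partial>\<^sub>j x\<^sub>i - x\<^sub>i \<partial>\<^sub>j = \<delta>\<^sub>i\<^sub>j\<close>; it is linear in the argument, hence a
  statement about single terms.
\<close>

lemma partial_deriv_mult_var:
  "partial_deriv j (var i * f) =
     var i * partial_deriv j f + (if i = j then f else 0)"
proof (induction f rule: mpoly_induct)
  case zero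
  show ?case by simp
next
  case (add_term f \<alpha> c)
  let ?e = "Poly_Mapping.single i 1 :: 'a multi_index"
  have "partial_deriv j (Poly_Mapping.single (?e + \<alpha>) c) =
     var i * partial_deriv j (Poly_Mapping.single \<alpha> c) +
     (if i = j then Poly_Mapping.single \<alpha> c else 0)"
  proof (cases "i = j")
    case True
    have "Poly_Mapping.single (?e + (\<alpha> - ?e)) (c * real (Poly_Mapping.lookup \<alpha> i)) =
        Poly_Mapping.single \<alpha> (c * real (Poly_Mapping.lookup \<alpha> i))"
      using multi_index_remove_unit[of \<alpha> i]
      by (cases "Poly_Mapping.lookup \<alpha> i = 0") (simp_all add: add.commute)
    with True show ?thesis
      by (simp add: partial_deriv_single var_def monomial_def mult_single lookup_add distrib_left
          single_add[symmetric] add.commute)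
  next
    case False
    then have "?e + \<alpha> - Poly_Mapping.single j 1 = ?e + (\<alpha> - Poly_Mapping.single j 1)"
      by (intro poly_mapping_eqI) (auto simp: lookup_add lookup_minus lookup_single when_def)
    with False show ?thesis
      by (simp add: partial_deriv_single var_def monomial_def mult_single lookup_add lookup_single)
  qed
  with add_term show ?case
    by (simp add: distrib_left partial_deriv_add mult_single var_def monomial_def)
qed

lemma partial_deriv_funpow_add:
  "(partial_deriv i ^^ k) (f + g) = (partial_deriv i ^^ k) f + (partial_deriv i ^^ k) g"
  by (induction k) (simp_all add: partial_deriv_add)

lemma partial_deriv_funpow_mult_const:
  "(partial_deriv i ^^ k) (Poly_Mapping.single 0 c * f) =
     Poly_Mapping.single 0 c * (partial_deriv i ^^ k) f"
  by (induction k) (simp_all add: partial_deriv_mult_const)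

lemma partial_deriv_funpow_mult_var:
  "(partial_deriv j ^^ k) (var i * f) =
     var i * (partial_deriv j ^^ k) f +
     (if i = j then Poly_Mapping.single 0 (real k) * (partial_deriv j ^^ (k - 1)) f else 0)"
proof (induction k)
  case 0
  show ?case by simp
next
  case (Suc k)
  have "Poly_Mapping.single 0 (real k) * partial_deriv j ((partial_deriv j ^^ (k - 1)) f) =
      Poly_Mapping.single 0 (real k) * (partial_deriv j ^^ k) f"
    by (cases k) simp_all
  then show ?case
    using Suc by (simp add: partial_deriv_add partial_deriv_mult_var partial_deriv_mult_const
        algebra_simps single_add del: single_of_nat)
qed

lemma partial_derivs_add:
  "partial_derivs \<beta> (f + g) = partial_derivs \<beta> f + partial_derivs \<beta> g"
proof -
  have "foldr (\<lambda>i. partial_deriv i ^^ Poly_Mapping.lookup \<beta> i) xs (f + g) =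
      foldr (\<lambda>i. partial_deriv i ^^ Poly_Mapping.lookup \<beta> i) xs f +
      foldr (\<lambda>i. partial_deriv i ^^ Poly_Mapping.lookup \<beta> i) xs g" for xs
    by (induction xs) (simp_all add: partial_deriv_funpow_add)
  then show ?thesis by (simp add: partial_derivs_def)
qed

lemma partial_derivs_mult_const:
  "partial_derivs \<beta> (Poly_Mapping.single 0 c * f) = Poly_Mapping.single 0 c * partial_derivs \<beta> f"
proof -
  have "foldr (\<lambda>i. partial_deriv i ^^ Poly_Mapping.lookup \<beta> i) xs (Poly_Mapping.single 0 c * f) =
      Poly_Mapping.single 0 c * foldr (\<lambda>i. partial_deriv i ^^ Poly_Mapping.lookup \<beta> i) xs f" for xs
    by (induction xs) (simp_all add: partial_deriv_funpow_mult_const)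
  then show ?thesis by (simp add: partial_derivs_def)
qed

text \<open>
  The operators \<open>\<partial>\<^sub>j\<close> are applied one variable after the other, and only the power of \<open>\<partial>\<^sub>i\<close> fails
  to commute with \<open>x\<^sub>i\<close>. The truncated difference \<open>\<beta> - e\<^sub>i\<close> is meaningful only if \<open>\<beta>\<^sub>i > 0\<close>; otherwise
  the factor \<open>\<beta>\<^sub>i\<close> removes the second summand.
\<close>

lemma partial_derivs_mult_var:
  fixes f :: "'d::{finite,linorder} mpoly"
  shows "partial_derivs \<beta> (var i * f) =
     var i * partial_derivs \<beta> f +
     Poly_Mapping.single 0 (real (Poly_Mapping.lookup \<beta> i)) *
       partial_derivs (\<beta> - Poly_Mapping.single i 1) f"
proof -
  define D where
    "D \<gamma> = foldr (\<lambda>j. partial_deriv j ^^ Poly_Mapping.lookup \<gamma> j)" for \<gamma> :: "'d multi_index"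
  define e :: "'d multi_index" where "e = Poly_Mapping.single i 1"
  have skip: "D (\<beta> - e) xs f = D \<beta> xs f" if "i \<notin> set xs" for xs
    using that by (induction xs) (auto simp: D_def e_def lookup_minus lookup_single_not_eq)
  have lookup_e: "Poly_Mapping.lookup (\<beta> - e) j = Poly_Mapping.lookup \<beta> j - 1" if "i = j" for j
    using that by (simp add: e_def lookup_minus)
  (* Induction over the variables: once the head j = i has been treated, i no longer occurs in
     the tail, where beta and beta - e prescribe the same derivatives. *)
  have "D \<beta> xs (var i * f) = var i * D \<beta> xs f +
      (if i \<in> set xs then Poly_Mapping.single 0 (real (Poly_Mapping.lookup \<beta> i)) * D (\<beta> - e) xs f
       else 0)" if "distinct xs" for xs
    using that
  proof (induction xs)
    case Nil
    show ?case by (simp add: D_def)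
  next
    case (Cons j xs)
    have D_Cons: "D \<gamma> (j # xs) g = (partial_deriv j ^^ Poly_Mapping.lookup \<gamma> j) (D \<gamma> xs g)" for \<gamma> g
      by (simp add: D_def)
    show ?case
    proof (cases "i = j")
      case True
      with Cons.prems have "i \<notin> set xs" by simp
      with Cons True show ?thesis
        using partial_deriv_funpow_mult_var[of _ j j] skip[of xs]
        by (simp add: D_Cons lookup_e[OF True])
    next
      case False
      then have "Poly_Mapping.lookup (\<beta> - e) j = Poly_Mapping.lookup \<beta> j"
        by (simp add: e_def lookup_minus lookup_single_not_eq)
      moreover have "(partial_deriv j ^^ k) (var i * g) = var i * (partial_deriv j ^^ k) g"
        for k g
        unfolding partial_deriv_funpow_mult_var using False by simp
      moreover have "(partial_deriv j ^^ k) 0 = 0" for k :: nat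
        by (induction k) simp_all
      ultimately show ?thesis
        using Cons False
        by (auto simp: D_Cons partial_deriv_funpow_add partial_deriv_funpow_mult_const
            simp del: single_of_nat)
    qed
  qed
  from this[of "sorted_list_of_set UNIV"] show ?thesis
    by (simp add: partial_derivs_def D_def e_def)
qed


section \<open>Derivatives at a point\<close>

definition deriv_at :: "real ^ 'd::{finite,linorder} \<Rightarrow> 'd multi_index \<Rightarrow> 'd mpoly \<Rightarrow> real" where
  "deriv_at a \<beta> f = eval_mpoly (partial_derivs \<beta> f) a"

lemma deriv_at_add: "deriv_at a \<beta> (f + g) = deriv_at a \<beta> f + deriv_at a \<beta> g"
  by (simp add: deriv_at_def partial_derivs_add eval_mpoly_add)

lemma deriv_at_mult_const: "deriv_at a \<beta> (Poly_Mapping.single 0 c * f) = c * deriv_at a \<beta> f"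
  by (simp add: deriv_at_def partial_derivs_mult_const eval_mpoly_mult_const)

lemma deriv_at_zero [simp]: "deriv_at a \<beta> 0 = 0"
  using deriv_at_mult_const[of a \<beta> 0 0] by simp

lemma deriv_at_diff: "deriv_at a \<beta> (f - g) = deriv_at a \<beta> f - deriv_at a \<beta> g"
  using deriv_at_add[of a \<beta> "f - g" g] by simp

lemma deriv_at_sum: "deriv_at a \<beta> (sum F A) = (\<Sum>x\<in>A. deriv_at a \<beta> (F x))"
  by (induction A rule: infinite_finite_induct) (simp_all add: deriv_at_add)

text \<open>
  Evaluating the commutation relation at \<open>a\<close> turns the variable \<open>x\<^sub>i\<close> into the number \<open>a\<^sub>i\<close>.
\<close>

lemma deriv_at_mult_linear:
  "deriv_at a \<beta> ((var i - Poly_Mapping.single 0 b) * f) =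
     (a $ i - b) * deriv_at a \<beta> f +
     real (Poly_Mapping.lookup \<beta> i) * deriv_at a (\<beta> - Poly_Mapping.single i 1) f"
  by (simp add: left_diff_distrib deriv_at_diff deriv_at_mult_const)
    (simp add: deriv_at_def partial_derivs_mult_var eval_mpoly_add eval_mpoly_mult_const
      eval_mpoly_mult_var left_diff_distrib del: single_of_nat)

definition vanishes :: "nat \<Rightarrow> real ^ 'd::{finite,linorder} \<Rightarrow> 'd mpoly \<Rightarrow> bool" where
  "vanishes n a f \<longleftrightarrow> (\<forall>\<beta>. total_deg \<beta> < n \<longrightarrow> deriv_at a \<beta> f = 0)"

lemma vanishes_add: "vanishes n a f \<Longrightarrow> vanishes n a g \<Longrightarrow> vanishes n a (f + g)"
  by (simp add: vanishes_def deriv_at_add)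

lemma vanishes_sum: "(\<And>x. x \<in> A \<Longrightarrow> vanishes n a (F x)) \<Longrightarrow> vanishes n a (sum F A)"
  by (simp add: vanishes_def deriv_at_sum)

text \<open>
  Both summands of \<open>deriv_at_mult_linear\<close> vanish: the second one involves a derivative of order one
  less, so it vanishes even one order further, and for \<open>b = a\<^sub>i\<close> it is the only one.
\<close>

lemma vanishes_mult_linear:
  assumes "vanishes n a f"
  shows "vanishes n a ((var i - Poly_Mapping.single 0 b) * f)"
    and "vanishes (Suc n) a
      ((var i - Poly_Mapping.single 0 (a $ i)) * f)"
proof -
  have *: "real (Poly_Mapping.lookup \<beta> i) * deriv_at a (\<beta> - Poly_Mapping.single i 1) f = 0"
    if "total_deg \<beta> < Suc n" for \<beta>
    using assms that total_deg_remove_unit[of \<beta> i]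
    by (cases "Poly_Mapping.lookup \<beta> i = 0") (auto simp: vanishes_def)
  show "vanishes n a ((var i - Poly_Mapping.single 0 b) * f)"
    using assms * unfolding vanishes_def deriv_at_mult_linear by simp
  show "vanishes (Suc n) a
      ((var i - Poly_Mapping.single 0 (a $ i)) * f)"
    using * unfolding vanishes_def deriv_at_mult_linear by simp
qed

lemma vanishes_mult:
  assumes f: "vanishes n a f"
  shows "vanishes n a (g * f)"
proof (induction g rule: mpoly_induct)
  case zero
  show ?case by (simp add: vanishes_def)
next
  case (add_term g \<alpha> c)
  have "vanishes n a (monomial \<alpha> * f)"
  proof (induction \<alpha> rule: multi_index_induct)
    case zero
    with f show ?case by (simp add: monomial_def)
  next
    case (add_unit \<alpha> i)
    have "monomial (\<alpha> + Poly_Mapping.single i 1) * f =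
        (var i - Poly_Mapping.single 0 0) * (monomial \<alpha> * f)"
      by (simp add: var_def monomial_def mult_single add.commute flip: mult.assoc)
    with vanishes_mult_linear(1)[OF add_unit] show ?case by metis
  qed
  then have "vanishes n a (Poly_Mapping.single 0 c * (monomial \<alpha> * f))"
    by (simp add: vanishes_def deriv_at_mult_const)
  then have "vanishes n a (Poly_Mapping.single \<alpha> c * f)"
    by (simp add: monomial_def mult_single flip: mult.assoc)
  with add_term show ?case
    by (simp add: distrib_right vanishes_add)
qed

lemma hermite_ideal_eq_vanishes:
  "hermite_ideal m X p = {f. \<forall>q\<in>{1..m}. vanishes (Suc (p q)) (X q) f}"
  by (simp add: hermite_ideal_def vanishes_def deriv_at_def less_Suc_eq_le)

lemma ideal_hermite_ideal: "module.subspace (*) (hermite_ideal m X p)"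
  unfolding hermite_ideal_eq_vanishes
  by (rule module.subspaceI[OF module_mpoly_times])
    (auto simp: vanishes_add vanishes_mult, simp add: vanishes_def)


section \<open>Hermite interpolation without degree restrictions\<close>

text \<open>
  A point \<open>b \<noteq> a\<close> differs from \<open>a\<close> in some coordinate \<open>i\<close>, and \<open>(x\<^sub>i - b\<^sub>i)\<^sup>n\<close> vanishes to order \<open>n\<close> at \<open>b\<close>
  but not at \<open>a\<close>.
\<close>

lemma exists_separating_mpoly:
  assumes "finite A" "a \<notin> A"
  shows "\<exists>h. deriv_at a 0 h \<noteq> 0 \<and> (\<forall>b\<in>A. vanishes n b h)"
  using assms
proof (induction A rule: finite_induct)
  case empty
  have "partial_derivs 0 (monomial 0 :: 'a mpoly) = monomial 0"
  proof -
    have "foldr (\<lambda>i. partial_deriv i ^^ Poly_Mapping.lookup 0 i) xs f = f" for xs and f :: "'a mpoly"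
      by (induction xs) simp_all
    then show ?thesis by (simp add: partial_derivs_def)
  qed
  then have "deriv_at a 0 (monomial 0) = 1"
    by (simp add: deriv_at_def monomial_def eval_mpoly_single del: single_one)
  then show ?case by (intro exI[of _ "monomial 0"]) simp
next
  case (insert b A)
  then obtain h where h: "deriv_at a 0 h \<noteq> 0" "\<forall>b\<in>A. vanishes n b h" by auto
  from insert.prems have "a \<noteq> b" by auto
  then obtain i where i: "a $ i \<noteq> b $ i" by (auto simp: vec_eq_iff)
  define l where "l = var i - Poly_Mapping.single 0 (b $ i)"
  have "vanishes k b (l ^ k * h)" for k
  proof (induction k)
    case 0
    show ?case by (simp add: vanishes_def)
  next
    case (Suc k)
    then show ?case using vanishes_mult_linear(2)[OF Suc, of i] by (simp add: l_def mult.assoc)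
  qed
  moreover have "deriv_at a 0 (l ^ k * h) \<noteq> 0" for k
    by (induction k) (use h i in \<open>simp_all add: l_def deriv_at_mult_linear mult.assoc\<close>)
  ultimately show ?case
    using h(2) by (intro exI[of _ "l ^ n * h"]) (simp add: vanishes_mult)
qed

text \<open>
  The polynomial is \<open>(x - a)\<^sup>\<alpha> h\<close> with \<open>h\<close> separating \<open>a\<close> from the points of \<open>A\<close>. Its expansion at \<open>a\<close> begins
  with \<open>h(a) (x - a)\<^sup>\<alpha>\<close>, and all further terms have degree greater than \<open>|\<alpha>|\<close>.
\<close>

lemma exists_jet_basis_mpoly:
  fixes a :: "real ^ 'd::{finite,linorder}"
  assumes "finite A" "a \<notin> A"
  shows "\<exists>u. deriv_at a \<alpha> u \<noteq> 0 \<and>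
    (\<forall>\<beta>. \<beta> \<noteq> \<alpha> \<longrightarrow> total_deg \<beta> \<le> total_deg \<alpha> \<longrightarrow> deriv_at a \<beta> u = 0) \<and> (\<forall>b\<in>A. vanishes n b u)"
proof (induction \<alpha> rule: multi_index_induct)
  case zero
  have "\<beta> = 0" if "total_deg \<beta> \<le> 0" for \<beta> :: "'d multi_index"
    using that by (auto simp: total_deg_def intro!: poly_mapping_eqI)
  with exists_separating_mpoly[OF assms, of n] show ?case by fastforce
next
  case (add_unit \<alpha> i)
  let ?e = "Poly_Mapping.single i 1 :: 'd multi_index"
  from add_unit obtain u where u: "deriv_at a \<alpha> u \<noteq> 0"
    "\<And>\<beta>. \<beta> \<noteq> \<alpha> \<Longrightarrow> total_deg \<beta> \<le> total_deg \<alpha> \<Longrightarrow> deriv_at a \<beta> u = 0" "\<forall>b\<in>A. vanishes n b u"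
    by blast
  define v where "v = (var i - Poly_Mapping.single 0 (a $ i)) * u"
  have v: "deriv_at a \<beta> v = real (Poly_Mapping.lookup \<beta> i) * deriv_at a (\<beta> - ?e) u" for \<beta>
    unfolding v_def deriv_at_mult_linear by simp
  have "deriv_at a (\<alpha> + ?e) v \<noteq> 0"
    using u(1) unfolding v by (simp add: lookup_add)
  moreover have "deriv_at a \<beta> v = 0"
    if "\<beta> \<noteq> \<alpha> + ?e" "total_deg \<beta> \<le> total_deg (\<alpha> + ?e)" for \<beta>
  proof (cases "Poly_Mapping.lookup \<beta> i = 0")
    case False
    then have "\<beta> - ?e \<noteq> \<alpha>" "total_deg (\<beta> - ?e) \<le> total_deg \<alpha>"
      using that multi_index_remove_unit[of \<beta> i] total_deg_remove_unit[of \<beta> i]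
      by (auto simp: total_deg_add)
    with u(2) v show ?thesis by simp
  qed (simp add: v)
  moreover have "\<forall>b\<in>A. vanishes n b v"
    using u(3) by (simp add: v_def vanishes_mult)
  ultimately show ?case by blast
qed

text \<open>
  The derivatives are adjusted in the order of increasing total degree: the correction in degree
  \<open>k\<close> is a combination of jet basis polynomials for \<open>|\<alpha>| = k\<close>, which leaves the lower orders and the
  other points untouched.
\<close>

lemma exists_mpoly_with_jet:
  fixes a :: "real ^ 'd::{finite,linorder}"
  assumes "finite A" "a \<notin> A"
  shows "\<exists>f. (\<forall>\<beta>. total_deg \<beta> < k \<longrightarrow> deriv_at a \<beta> f = c \<beta>) \<and> (\<forall>b\<in>A. vanishes n b f)"
proof (induction k)
  case 0
  show ?case by (intro exI[of _ 0]) (simp add: vanishes_def)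
next
  case (Suc k)
  then obtain f where f: "\<And>\<beta>. total_deg \<beta> < k \<Longrightarrow> deriv_at a \<beta> f = c \<beta>" "\<forall>b\<in>A. vanishes n b f"
    by blast
  obtain u where u: "\<And>\<alpha>. deriv_at a \<alpha> (u \<alpha>) \<noteq> 0"
    "\<And>\<alpha> \<beta>. \<beta> \<noteq> \<alpha> \<Longrightarrow> total_deg \<beta> \<le> total_deg \<alpha> \<Longrightarrow> deriv_at a \<beta> (u \<alpha>) = 0"
    "\<And>\<alpha>. \<forall>b\<in>A. vanishes n b (u \<alpha>)"
    using exists_jet_basis_mpoly[OF assms, of _ n] by metis
  define T where "T = {\<alpha> :: 'd multi_index. total_deg \<alpha> = k}"
  have T: "finite T"
    unfolding T_def by (rule finite_subset[OF _ finite_total_deg_le[of k]]) auto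
  define t where "t \<alpha> = (c \<alpha> - deriv_at a \<alpha> f) / deriv_at a \<alpha> (u \<alpha>)" for \<alpha>
  define g where "g = f + (\<Sum>\<alpha>\<in>T. Poly_Mapping.single 0 (t \<alpha>) * u \<alpha>)"
  have g: "deriv_at a \<beta> g = deriv_at a \<beta> f + (\<Sum>\<alpha>\<in>T. t \<alpha> * deriv_at a \<beta> (u \<alpha>))" for \<beta>
    by (simp add: g_def deriv_at_add deriv_at_sum deriv_at_mult_const)
  have "deriv_at a \<beta> g = c \<beta>" if "total_deg \<beta> < Suc k" for \<beta>
  proof (cases "\<beta> \<in> T")
    case True
    have "(\<Sum>\<alpha>\<in>T. t \<alpha> * deriv_at a \<beta> (u \<alpha>)) = (\<Sum>\<alpha>\<in>T. if \<alpha> = \<beta> then t \<beta> * deriv_at a \<beta> (u \<beta>) else 0)"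
      using True u(2) by (intro sum.cong) (auto simp: T_def)
    also have "\<dots> = c \<beta> - deriv_at a \<beta> f"
      using True T u(1) by (simp add: t_def)
    finally show ?thesis by (simp add: g)
  next
    case False
    with that have "total_deg \<beta> < k" by (simp add: T_def)
    moreover from this have "(\<Sum>\<alpha>\<in>T. t \<alpha> * deriv_at a \<beta> (u \<alpha>)) = 0"
      using u(2)[of \<beta>] by (intro sum.neutral) (force simp: T_def)
    ultimately show ?thesis using f(1) by (simp add: g)
  qed
  moreover have "\<forall>b\<in>A. vanishes n b g"
    using f(2) u(3) by (simp add: g_def vanishes_add vanishes_sum vanishes_mult)
  ultimately show ?case by blast
qed

lemma exists_hermite_interpolant:
  fixes A :: "(real ^ 'd::{finite,linorder}) set"
  assumes "finite A"
  shows "\<exists>f. \<forall>a\<in>A. \<forall>\<beta>. total_deg \<beta> < n \<longrightarrow> deriv_at a \<beta> f = c a \<beta>"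
proof -
  obtain F where F: "\<And>a \<beta>. total_deg \<beta> < n \<Longrightarrow> deriv_at a \<beta> (F a) = c a \<beta>"
    "\<And>a b. b \<in> A - {a} \<Longrightarrow> vanishes n b (F a)"
    using exists_mpoly_with_jet[of "A - {a}" a n "c a" n for a] assms
    by (metis Diff_iff finite_Diff insertI1)
  have "deriv_at a \<beta> (sum F A) = c a \<beta>" if "a \<in> A" "total_deg \<beta> < n" for a \<beta>
  proof -
    have "deriv_at a \<beta> (sum F A) = (\<Sum>b\<in>A. if b = a then c a \<beta> else 0)"
      unfolding deriv_at_sum using that F by (intro sum.cong) (auto simp: vanishes_def)
    then show ?thesis using that assms by simp
  qed
  then show ?thesis by blast
qed


section \<open>Division with remainder by an ideal\<close>

text \<open>
  The leading ideal is generated by monomials, so that being divisible by a generator is a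
  property of each monomial of a linear combination of generators separately.
\<close>

lemma keys_lead_ideal:
  fixes f :: "'d::{finite,linorder} mpoly"
  assumes "f \<in> lead_ideal I" "\<alpha> \<in> Poly_Mapping.keys f"
  shows "\<exists>g\<in>I - {0}. \<exists>\<gamma>. \<alpha> = \<gamma> + lead_exp g"
  using assms(1)[unfolded lead_ideal_def ideal_generated_def] assms(2)
proof (induction arbitrary: \<alpha> rule: module.span_induct_alt[OF module_mpoly_times, consumes 1])
  case 1
  then show ?case by simp
next
  case (2 r h y)
  show ?case
  proof (cases "\<alpha> \<in> Poly_Mapping.keys y")
    case True
    with 2 show ?thesis by blast
  next
    case False
    with 2 have "\<alpha> \<in> Poly_Mapping.keys (r * h)"
      using keys_add[of "r * h" y] by blast
    then obtain \<gamma> \<delta> where gd: "\<alpha> = \<gamma> + \<delta>" "\<delta> \<in> Poly_Mapping.keys h"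
      using keys_mult[of r h] by blast
    from 2 obtain g where g: "g \<in> I - {0}" "h = lead_term g" by blast
    with gd have "\<delta> = lead_exp g"
      by (auto simp: lead_term_def split: if_splits)
    with g gd show ?thesis by blast
  qed
qed

lemma monomial_lead_exp_in_lead_ideal:
  assumes "g \<in> I" "g \<noteq> 0"
  shows "monomial (lead_exp g) \<in> lead_ideal I"
proof -
  let ?l = "Poly_Mapping.lookup g (lead_exp g)"
  have "?l \<noteq> 0" using lead_exp(1)[OF assms(2)] by (simp add: in_keys_iff)
  then have "monomial (lead_exp g) = Poly_Mapping.single 0 (1 / ?l) * lead_term g"
    by (simp add: monomial_def lead_term_def mult_single)
  moreover have "lead_term g \<in> lead_ideal I"
    unfolding lead_ideal_def ideal_generated_def
    using assms by (intro module.span_base[OF module_mpoly_times]) auto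
  ultimately show ?thesis
    unfolding lead_ideal_def ideal_generated_def
    by (simp add: module.span_scale[OF module_mpoly_times])
qed

lemma keys_S_space:
  assumes "f \<in> S_space I" "\<alpha> \<in> Poly_Mapping.keys f"
  shows "monomial \<alpha> \<notin> lead_ideal I"
  using assms(1)[unfolded S_space_def] assms(2)
proof (induction arbitrary: \<alpha> rule: module.span_induct_alt[OF module_scale_mpoly, consumes 1])
  case 1
  then show ?case by simp
next
  case (2 r h y)
  from 2 obtain \<beta> where \<beta>: "h = monomial \<beta>" "monomial \<beta> \<notin> lead_ideal I" by blast
  have "Poly_Mapping.keys (scale_mpoly r h) \<subseteq> {\<beta>}"
    by (simp add: \<beta> scale_mpoly_eq_mult monomial_def mult_single)
  with 2 \<beta> show ?case using keys_add[of "scale_mpoly r h" y] by blast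
qed

lemma S_space_Int_ideal:
  assumes "f \<in> S_space I" "f \<in> I"
  shows "f = 0"
  using assms keys_S_space[of f I "lead_exp f"] lead_exp(1)[of f] monomial_lead_exp_in_lead_ideal[of f I]
  by blast

lemma keys_cancel_lead:
  assumes f: "f \<noteq> 0" and g: "g \<noteq> 0" "lead_exp g = lead_exp f"
    "Poly_Mapping.lookup g (lead_exp f) = Poly_Mapping.lookup f (lead_exp f)"
    and "f - g \<noteq> 0"
  shows "grlex_less (lead_exp (f - g)) (lead_exp f)"
proof -
  let ?\<alpha> = "lead_exp (f - g)"
  have "?\<alpha> \<in> Poly_Mapping.keys (f - g)" using assms by (intro lead_exp(1))
  then have "?\<alpha> \<noteq> lead_exp f" "?\<alpha> \<in> Poly_Mapping.keys f \<union> Poly_Mapping.keys g"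
    using g(3) keys_diff[of f g] by (auto simp: in_keys_iff lookup_minus)
  then show ?thesis using lead_exp(2) f g by (metis Un_iff)
qed

lemma lead_exp_eqI:
  assumes "\<alpha> \<in> Poly_Mapping.keys f"
    and "\<And>\<beta>. \<beta> \<in> Poly_Mapping.keys f \<Longrightarrow> \<beta> \<noteq> \<alpha> \<Longrightarrow> grlex_less \<beta> \<alpha>"
  shows "lead_exp f = \<alpha>"
proof -
  have "f \<noteq> 0" using assms(1) by auto
  with assms lead_exp[of f] grlex_less_trans grlex_less_irrefl show ?thesis by metis
qed

lemma lookup_single_mult:
  fixes g :: "'d mpoly"
  shows "Poly_Mapping.lookup (Poly_Mapping.single \<gamma> c * g) (\<gamma> + \<delta>) = c * Poly_Mapping.lookup g \<delta>"
  by (induction g rule: mpoly_induct)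
    (simp_all add: distrib_left lookup_add mult_single lookup_single when_def)

lemma lead_exp_single_mult:
  fixes g :: "'d::{finite,linorder} mpoly"
  assumes "g \<noteq> 0" "c \<noteq> 0"
  shows "lead_exp (Poly_Mapping.single \<gamma> c * g) = \<gamma> + lead_exp g"
proof (rule lead_exp_eqI)
  show "\<gamma> + lead_exp g \<in> Poly_Mapping.keys (Poly_Mapping.single \<gamma> c * g)"
    using assms lead_exp(1)[of g] by (simp add: in_keys_iff lookup_single_mult)
  fix \<beta> assume "\<beta> \<in> Poly_Mapping.keys (Poly_Mapping.single \<gamma> c * g)" "\<beta> \<noteq> \<gamma> + lead_exp g"
  then obtain \<delta> where "\<beta> = \<gamma> + \<delta>" "\<delta> \<in> Poly_Mapping.keys g" "\<delta> \<noteq> lead_exp g"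
    using keys_mult[of "Poly_Mapping.single \<gamma> c" g] assms by auto
  then show "grlex_less \<beta> (\<gamma> + lead_exp g)"
    using lead_exp(2)[OF assms(1)] by (simp add: grlex_less_add_left)
qed

text \<open>
  Cancelling the leading term makes the leading exponent smaller, which cannot go on forever since
  the graded lexicographic order is well-founded.
\<close>

lemma exists_remainder:
  fixes I :: "'d::{finite,linorder} mpoly set"
  assumes ideal: "module.subspace (*) I"
  shows "\<exists>r\<in>S_space I. f - r \<in> I"
proof -
  have zero: "0 \<in> S_space I" "0 \<in> I"
    by (simp_all add: S_space_def module.span_zero[OF module_scale_mpoly]
        module.subspace_0[OF module_mpoly_times ideal])
  have nonzero: "\<exists>r\<in>S_space I. f - r \<in> I" if "f \<noteq> 0" "lead_exp f = \<alpha>" for f \<alpha>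
    using that
  proof (induction \<alpha> arbitrary: f rule: wfp_induct_rule[OF wfp_grlex_less])
    case (1 \<alpha> f)
    let ?c = "Poly_Mapping.lookup f \<alpha>"
    have c: "?c \<noteq> 0" using 1 lead_exp(1)[of f] by (simp add: in_keys_iff)
    (* Subtracting any polynomial with the leading term of f allows the induction hypothesis. *)
    have step: "\<exists>r\<in>S_space I. (f - g) - r \<in> I"
      if "g \<noteq> 0" "lead_exp g = \<alpha>" "Poly_Mapping.lookup g \<alpha> = ?c" for g
    proof (cases "f - g = 0")
      case True
      then show ?thesis using zero by force
    next
      case False
      with that 1(2,3) have "grlex_less (lead_exp (f - g)) \<alpha>"
        using keys_cancel_lead[of f g] by simp
      with False show ?thesis using 1(1) by blast
    qed
    show ?case
    proof (cases "monomial \<alpha> \<in> lead_ideal I")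
      case False
      define t where "t = Poly_Mapping.single \<alpha> ?c"
      have t_eq: "t = scale_mpoly ?c (monomial \<alpha>)"
        by (simp add: t_def scale_mpoly_eq_mult monomial_def mult_single)
      have t: "t \<in> S_space I"
        unfolding S_space_def t_eq
        by (intro module.span_scale[OF module_scale_mpoly] module.span_base[OF module_scale_mpoly])
          (use False in blast)
      have "lead_exp t = \<alpha>" "t \<noteq> 0"
        using c by (auto simp: t_def intro!: lead_exp_eqI simp flip: keys_eq_empty split: if_splits)
      then have "\<exists>r\<in>S_space I. (f - t) - r \<in> I"
        by (intro step) (simp_all add: t_def)
      then obtain r where r: "r \<in> S_space I" "f - t - r \<in> I" by blast
      then have "t + r \<in> S_space I"
        using t unfolding S_space_def by (intro module.span_add[OF module_scale_mpoly])
      with r show ?thesis by (metis diff_diff_eq)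
    next
      case True
      then obtain g \<gamma> where g: "g \<in> I" "g \<noteq> 0" "\<alpha> = \<gamma> + lead_exp g"
        using keys_lead_ideal[of "monomial \<alpha>" I \<alpha>] by (auto simp: monomial_def)
      define l where "l = Poly_Mapping.lookup g (lead_exp g)"
      have l: "l \<noteq> 0" using lead_exp(1)[OF g(2)] by (simp add: l_def in_keys_iff)
      define t where "t = Poly_Mapping.single \<gamma> (?c / l) * g"
      have tI: "t \<in> I"
        unfolding t_def using module.subspace_scale[OF module_mpoly_times ideal] g(1) by blast
      have lc: "Poly_Mapping.lookup t \<alpha> = ?c"
        using l unfolding t_def g(3) lookup_single_mult by (simp add: l_def)
      then have "t \<noteq> 0" using c by auto
      moreover have "lead_exp t = \<alpha>"
        unfolding t_def using g c l by (simp add: lead_exp_single_mult)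
      ultimately obtain r where r: "r \<in> S_space I" "f - t - r \<in> I"
        using step lc by blast
      then have "(f - t - r) + t \<in> I"
        using tI by (intro module.subspace_add[OF module_mpoly_times ideal])
      with r show ?thesis by (intro bexI[of _ r]) (simp_all add: algebra_simps)
    qed
  qed
  show ?thesis
  proof (cases "f = 0")
    case True
    with zero show ?thesis by force
  qed (use nonzero in blast)
qed


section \<open>Interpolation in the complement of the leading ideal\<close>

theorem theorem2:
  fixes m :: nat
    and X :: "nat \<Rightarrow> real ^ 'd::{finite,linorder}"
    and p :: "nat \<Rightarrow> nat"
    and c :: "nat \<Rightarrow> 'd multi_index \<Rightarrow> real"
  assumes "CARD('d) \<ge> 2"
    and "m \<ge> 2"
    and "inj_on X {1..m}"
  shows "\<exists>!f. f \<in> S_space (hermite_ideal m X p) \<and>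
    (\<forall>q\<in>{1..m}. \<forall>\<alpha>. total_deg \<alpha> \<le> p q \<longrightarrow>
       eval_mpoly (partial_derivs \<alpha> f) (X q) = c q \<alpha>)"
  unfolding deriv_at_def[symmetric]
proof (rule ex_ex1I)
  let ?I = "hermite_ideal m X p"
  (* Prescribing the derivatives up to the largest order at all nodes is possible as well;
     the surplus values are arbitrary. *)
  define n where "n = Suc (Max (p ` {1..m}))"
  have n: "total_deg \<alpha> < n" if "q \<in> {1..m}" "total_deg \<alpha> \<le> p q" for q and \<alpha> :: "'d multi_index"
  proof -
    have "p q \<le> Max (p ` {1..m})" using that by (intro Max_ge) auto
    with that show ?thesis unfolding n_def by linarith
  qed
  obtain F where F: "\<And>a \<beta>. a \<in> X ` {1..m} \<Longrightarrow> total_deg \<beta> < n \<Longrightarrow>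
      deriv_at a \<beta> F = c (inv_into {1..m} X a) \<beta>"
    using exists_hermite_interpolant[of "X ` {1..m}" n "\<lambda>a. c (inv_into {1..m} X a)"] by blast
  obtain r where r: "r \<in> S_space ?I" "F - r \<in> ?I"
    using exists_remainder[OF ideal_hermite_ideal] by blast
  have "deriv_at (X q) \<alpha> r = c q \<alpha>" if q: "q \<in> {1..m}" "total_deg \<alpha> \<le> p q" for q \<alpha>
  proof -
    have "deriv_at (X q) \<alpha> (F - r) = 0"
      using r(2) q by (simp add: hermite_ideal_eq_vanishes vanishes_def)
    moreover have "deriv_at (X q) \<alpha> F = c q \<alpha>"
      using F[of "X q" \<alpha>] n[OF q] q assms(3) by (simp add: inv_into_f_f)
    ultimately show ?thesis by (simp add: deriv_at_diff)
  qed
  with r(1) show "\<exists>f. f \<in> S_space ?I \<and>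
      (\<forall>q\<in>{1..m}. \<forall>\<alpha>. total_deg \<alpha> \<le> p q \<longrightarrow> deriv_at (X q) \<alpha> f = c q \<alpha>)"
    by blast
next
  let ?I = "hermite_ideal m X p"
  fix f g
  assume f: "f \<in> S_space ?I \<and>
      (\<forall>q\<in>{1..m}. \<forall>\<alpha>. total_deg \<alpha> \<le> p q \<longrightarrow> deriv_at (X q) \<alpha> f = c q \<alpha>)"
    and g: "g \<in> S_space ?I \<and>
      (\<forall>q\<in>{1..m}. \<forall>\<alpha>. total_deg \<alpha> \<le> p q \<longrightarrow> deriv_at (X q) \<alpha> g = c q \<alpha>)"
  then have "f - g \<in> S_space ?I"
    unfolding S_space_def by (intro module.span_diff[OF module_scale_mpoly]) auto
  moreover have "f - g \<in> ?I"
    using f g by (simp add: hermite_ideal_eq_vanishes vanishes_def deriv_at_diff less_Suc_eq_le)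
  ultimately show "f = g"
    using S_space_Int_ideal[of "f - g" ?I] by simp
qed

end
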